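(* For each real number $u>0$, $$u=\lim_{m\to\infty}\sum_{k=1}^{m}\binom{m}{k}\frac{(-1)^{k+1}}{k}\ln(ku+1)=\sum_{m=1}^{\infty}\sum_{k=1}^{m}\binom{m}{k}\frac{(-1)^{k+1}}{m}\ln(ku+1).$$
   Context: Here $m$ ranges over the positive integers, $\binom{m}{k}$ denotes the binomial coefficient, and $\ln$ is the natural logarithm. In the last expression, for each $m$ the inner finite sum over $k$ is taken first, and the outer sum over $m$ is an infinite series. *)

theory Defs
  imports Complex_Main
begin

end

theory Submission
  imports Defs "HOL-Analysis.Harmonic_Numbers"
begin

text \<open>
  Let \<open>S\<^sub>m(t)\<close> be the finite sum in the first claim, with \<open>u\<close> replaced by \<open>t\<close>.  Differentiation in \<open>t\<close>
  cancels the factor \<open>1/k\<close> and the logarithm, so that \<open>t - S\<^sub>m(t)\<close> has the derivative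
  \<open>\<Sum>k\<le>m. (m choose k) (-1)^k / (1 + k t)\<close>.  By the partial fraction formula
  (\<open>alternating_binomial_partial_fraction\<close>) this is the product of the factors \<open>k t / (1 + k t)\<close>,
  \<open>1 \<le> k \<le> m\<close>.  The product is nonnegative, and since the harmonic series diverges it tends to \<open>0\<close>;
  quantitatively it is at most \<open>t / (t + H\<^sub>m)\<close> with the harmonic number \<open>H\<^sub>m\<close> (\<open>prod_le_harm\<close>).
  As \<open>S\<^sub>m(0) = 0\<close>, the mean value theorem gives \<open>0 \<le> u - S\<^sub>m(u) \<le> u\<^sup>2 / H\<^sub>m\<close>, which proves the limit.

  The series is the same statement read differently: its terms are the differences
  \<open>S\<^bsub>m+1\<^esub>(u) - S\<^sub>m(u)\<close> (\<open>binomial_sum_over_index_diff\<close>), so its partial sums telescope to \<open>S\<^sub>m(u)\<close>.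
\<close>

lemma alternating_binomial_sum_Suc:
  fixes f :: "nat \<Rightarrow> 'a::comm_ring_1"
  shows "(\<Sum>k\<le>Suc m. of_nat (Suc m choose k) * (-1) ^ k * f k)
       = (\<Sum>k\<le>m. of_nat (m choose k) * (-1) ^ k * f k)
         - (\<Sum>k\<le>m. of_nat (m choose k) * (-1) ^ k * f (Suc k))"
proof -
  let ?a = "\<lambda>n k. of_nat (n choose k) * (-1) ^ k * f k"
  have "(\<Sum>k\<le>Suc m. ?a (Suc m) k) = f 0 + (\<Sum>k\<le>m. ?a (Suc m) (Suc k))"
    by (subst sum.atMost_Suc_shift) simp
  also have "(\<Sum>k\<le>m. ?a (Suc m) (Suc k))
      = (\<Sum>k\<le>m. ?a m (Suc k)) - (\<Sum>k\<le>m. of_nat (m choose k) * (-1) ^ k * f (Suc k))"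
    unfolding sum_subtractf[symmetric] by (intro sum.cong refl) (simp add: algebra_simps)
  also have "f 0 + ((\<Sum>k\<le>m. ?a m (Suc k)) - (\<Sum>k\<le>m. of_nat (m choose k) * (-1) ^ k * f (Suc k)))
      = (\<Sum>k\<le>Suc m. ?a m k) - (\<Sum>k\<le>m. of_nat (m choose k) * (-1) ^ k * f (Suc k))"
    by (subst sum.atMost_Suc_shift) simp
  also have "(\<Sum>k\<le>Suc m. ?a m k) = (\<Sum>k\<le>m. ?a m k)"
    by (simp add: binomial_eq_0)
  finally show ?thesis .
qed

text \<open>
  The left-hand side is the \<open>m\<close>-th finite difference with step \<open>t\<close> of the function \<open>1/x\<close> at \<open>a\<close>, up to
  sign.  The base point \<open>a\<close> is kept general because the induction step compares the bases \<open>a\<close> and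
  \<open>a + t\<close>.
\<close>

lemma alternating_binomial_partial_fraction:
  fixes a t :: real
  assumes "a > 0" "t \<ge> 0"
  shows "(\<Sum>k\<le>m. real (m choose k) * (-1) ^ k * (1 / (a + real k * t)))
       = (\<Prod>k=1..m. real k * t / (a + real k * t)) / a"
  using assms(1)
proof (induction m arbitrary: a)
  case 0
  then show ?case by simp
next
  case (Suc m)
  let ?P = "\<lambda>b. \<Prod>k=1..m. real k * t / (b + real k * t)"
  let ?D = "\<Prod>k=1..m. a + real k * t"
  let ?E = "\<Prod>k=1..m. (a + t) + real k * t"
  have pos: "a + real k * t > 0" for k
    using Suc.prems assms(2) by (simp add: add_pos_nonneg)
  have at: "a + t > 0" using Suc.prems assms(2) by simp
  (* Both products contain the factors a + 2t, ..., a + mt. *)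
  have shift: "(a + t) * ?E = ?D * (a + real (Suc m) * t)"
  proof -
    have "(a + t) * ?E = (\<Prod>k\<in>{0..m}. (a + t) + real k * t)"
      by (simp add: prod.atLeast_Suc_atMost)
    also have "\<dots> = (\<Prod>k\<in>{Suc 0..Suc m}. a + real k * t)"
      unfolding prod.shift_bounds_cl_Suc_ivl by (intro prod.cong) (auto simp: algebra_simps)
    finally show ?thesis by simp
  qed
  have "(\<Sum>k\<le>Suc m. real (Suc m choose k) * (-1) ^ k * (1 / (a + real k * t)))
      = (\<Sum>k\<le>m. real (m choose k) * (-1) ^ k * (1 / (a + real k * t)))
        - (\<Sum>k\<le>m. real (m choose k) * (-1) ^ k * (1 / ((a + t) + real k * t)))"
    by (subst alternating_binomial_sum_Suc) (simp add: algebra_simps)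
  also have "\<dots> = ?P a / a - ?P (a + t) / (a + t)"
    using Suc.IH[OF Suc.prems] Suc.IH[OF at] by simp
  also have "?P (a + t) / (a + t) = (\<Prod>k=1..m. real k * t) / ((a + t) * ?E)"
    by (simp add: prod_dividef)
  also have "\<dots> = ?P a / (a + real (Suc m) * t)"
    unfolding shift by (simp add: prod_dividef)
  also have "?P a / a - ?P a / (a + real (Suc m) * t)
      = ?P a * (real (Suc m) * t / (a + real (Suc m) * t)) / a"
    using Suc.prems pos[of "Suc m"] by (simp add: divide_simps) (simp add: algebra_simps)
  finally show ?case by simp
qed

text \<open>
  The reciprocal of the product is \<open>\<Prod>(1 + 1/(k t)) \<ge> 1 + H\<^sub>m / t\<close>; the form without division by \<open>t\<close>
  goes through the induction directly.
\<close>

lemma prod_le_harm: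
  fixes t :: real
  assumes "t > 0"
  shows "(\<Prod>k=1..m. real k * t / (1 + real k * t)) * (t + harm m) \<le> t"
proof (induction m)
  case 0
  then show ?case by (simp add: harm_def)
next
  case (Suc m)
  let ?P = "\<Prod>k=1..m. real k * t / (1 + real k * t)"
  let ?n = "real (Suc m)"
  have P: "?P \<ge> 0" using assms by (intro prod_nonneg) auto
  have H: "harm m \<ge> (0::real)" by (rule harm_nonneg)
  have n: "?n > 0" by simp
  have d: "1 + ?n * t > 0" using assms by (simp add: add_pos_nonneg)
  have "?n * t * (t + harm (Suc m)) = ?n * t * (t + harm m) + t"
    using n by (simp add: harm_Suc field_simps)
  also have "\<dots> \<le> (t + harm m) * (1 + ?n * t)"
    using H by (simp add: algebra_simps)
  finally have "?n * t / (1 + ?n * t) * (t + harm (Suc m)) \<le> t + harm m"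
    using d by (simp add: pos_divide_le_eq)
  from mult_left_mono[OF this P]
  have "(\<Prod>k=1..Suc m. real k * t / (1 + real k * t)) * (t + harm (Suc m)) \<le> ?P * (t + harm m)"
    by (simp add: mult.assoc)
  with Suc.IH show ?case by linarith
qed

lemma binomial_ln_sum_error:
  fixes u :: real
  assumes "u > 0" "m > 0"
  shows "\<bar>u - (\<Sum>k=1..m. real (m choose k) * ((-1) ^ (k + 1) / real k) * ln (real k * u + 1))\<bar>
       \<le> u\<^sup>2 / harm m"
proof -
  define F where "F t = t - (\<Sum>k=1..m. real (m choose k) * ((-1) ^ (k + 1) / real k) * ln (real k * t + 1))"
    for t :: real
  define P where "P t = (\<Prod>k=1..m. real k * t / (1 + real k * t))" for t :: real
  have deriv: "(F has_real_derivative P t) (at t)" if "t \<ge> 0" for t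
  proof -
    have p: "real k * t + 1 > 0" for k using that by (simp add: add_nonneg_pos)
    have "(F has_real_derivative
        1 - (\<Sum>k=1..m. real (m choose k) * ((-1) ^ (k + 1) / real k) * (real k / (real k * t + 1)))) (at t)"
      unfolding F_def using p
      by (auto intro!: derivative_eq_intros sum.cong simp: less_imp_neq[symmetric])
    also have "(\<Sum>k=1..m. real (m choose k) * ((-1) ^ (k + 1) / real k) * (real k / (real k * t + 1)))
        = - (\<Sum>k=1..m. real (m choose k) * (-1) ^ k * (1 / (1 + real k * t)))"
      unfolding sum_negf[symmetric] by (intro sum.cong) (auto simp: add.commute)
    also have "1 - \<dots> = (\<Sum>k\<le>m. real (m choose k) * (-1) ^ k * (1 / (1 + real k * t)))"
      by (simp add: atMost_atLeast0 sum.atLeast_Suc_atMost)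
    also have "\<dots> = P t"
      using alternating_binomial_partial_fraction[of 1 t m] that by (simp add: P_def)
    finally show ?thesis .
  qed
  obtain z where z: "0 < z" "z < u" and F: "F u - F 0 = (u - 0) * P z"
    using MVT2[of 0 u F P] assms(1) deriv by auto
  have Fu: "F u = u * P z" using F by (simp add: F_def)
  have P0: "P z \<ge> 0" unfolding P_def using z by (intro prod_nonneg) auto
  have H: "harm m > (0::real)" using assms(2) by (simp add: harm_pos)
  have "P z * harm m \<le> P z * (z + harm m)"
    using P0 z by (intro mult_left_mono) auto
  also have "\<dots> \<le> z" unfolding P_def by (rule prod_le_harm) fact
  finally have "P z * harm m \<le> u" using z by simp
  then have "P z \<le> u / harm m" using H by (simp add: pos_le_divide_eq)
  then have "u * P z \<le> u\<^sup>2 / harm m"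
    using mult_left_mono[of "P z" "u / harm m" u] assms(1) by (simp add: power2_eq_square)
  moreover have "u * P z \<ge> 0" using P0 assms(1) by simp
  ultimately show ?thesis using Fu by (simp add: F_def)
qed

text \<open>
  By Pascal's rule only \<open>m choose (k - 1)\<close> survives in the difference of the coefficients, and the
  absorption identity \<open>k (Suc m choose k) = Suc m (m choose (k - 1))\<close> trades \<open>1/k\<close> for \<open>1/(m + 1)\<close>.
\<close>

lemma binomial_sum_over_index_diff:
  fixes g :: "nat \<Rightarrow> real"
  shows "(\<Sum>k=1..Suc m. real (Suc m choose k) * ((-1) ^ (k + 1) / real (Suc m)) * g k)
       = (\<Sum>k=1..Suc m. real (Suc m choose k) * ((-1) ^ (k + 1) / real k) * g k)
         - (\<Sum>k=1..m. real (m choose k) * ((-1) ^ (k + 1) / real k) * g k)"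
proof -
  have coeff: "real (Suc m choose k) / real (Suc m) = (real (Suc m choose k) - real (m choose k)) / real k"
    if "k \<in> {1..Suc m}" for k
  proof -
    from that obtain j where k: "k = Suc j" by (cases k) auto
    have "real (Suc j) * real (Suc m choose Suc j) = real (Suc m) * real (m choose j)"
      using Suc_times_binomial[of j m] by (simp only: of_nat_mult[symmetric])
    then have "real (Suc m choose Suc j) / real (Suc m) = real (m choose j) / real (Suc j)"
      by (simp add: frac_eq_eq mult.commute del: of_nat_Suc binomial_Suc_Suc)
    then show ?thesis unfolding k by simp
  qed
  have "real (Suc m choose k) * ((-1) ^ (k + 1) / real (Suc m)) * g k
      = real (Suc m choose k) * ((-1) ^ (k + 1) / real k) * g k
        - real (m choose k) * ((-1) ^ (k + 1) / real k) * g k" if "k \<in> {1..Suc m}" for k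
  proof -
    have "real (Suc m choose k) * ((-1) ^ (k + 1) / real (Suc m)) * g k
        = (real (Suc m choose k) / real (Suc m)) * (-1) ^ (k + 1) * g k" by simp
    also have "\<dots> = (real (Suc m choose k) - real (m choose k)) / real k * (-1) ^ (k + 1) * g k"
      unfolding coeff[OF that] ..
    finally show ?thesis by (simp add: diff_divide_distrib left_diff_distrib)
  qed
  then have "(\<Sum>k=1..Suc m. real (Suc m choose k) * ((-1) ^ (k + 1) / real (Suc m)) * g k)
      = (\<Sum>k=1..Suc m. real (Suc m choose k) * ((-1) ^ (k + 1) / real k) * g k)
        - (\<Sum>k=1..Suc m. real (m choose k) * ((-1) ^ (k + 1) / real k) * g k)"
    unfolding sum_subtractf[symmetric] by (rule sum.cong[OF refl])
  then show ?thesis by (simp add: binomial_eq_0)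
qed

theorem mainTheorem2:
  fixes u :: real
  assumes "u > 0"
  shows "(\<lambda>m::nat. \<Sum>k=1..m. real (m choose k) * ((-1) ^ (k + 1) / real k) * ln (real k * u + 1))
           \<longlonglongrightarrow> u
       \<and> (\<lambda>m::nat. \<Sum>k=1..Suc m. real (Suc m choose k) * ((-1) ^ (k + 1) / real (Suc m)) * ln (real k * u + 1))
           sums u"
proof
  let ?S = "\<lambda>m::nat. \<Sum>k=1..m. real (m choose k) * ((-1) ^ (k + 1) / real k) * ln (real k * u + 1)"
  have "(\<lambda>m. u\<^sup>2 / harm m) \<longlonglongrightarrow> 0"
    by (intro tendsto_divide_0[OF tendsto_const] filterlim_at_top_imp_at_infinity harm_at_top)
  moreover have "\<forall>\<^sub>F m in sequentially. norm (u - ?S m) \<le> u\<^sup>2 / harm m"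
    using eventually_gt_at_top[of 0]
    by eventually_elim (use binomial_ln_sum_error[OF assms] in simp)
  ultimately have "(\<lambda>m. u - ?S m) \<longlonglongrightarrow> 0"
    by (rule Lim_null_comparison[rotated])
  from tendsto_diff[OF tendsto_const[of u] this] show lim: "?S \<longlonglongrightarrow> u" by simp
  show "(\<lambda>m::nat. \<Sum>k=1..Suc m. real (Suc m choose k) * ((-1) ^ (k + 1) / real (Suc m)) * ln (real k * u + 1))
           sums u"
    unfolding binomial_sum_over_index_diff using telescope_sums[OF lim] by simp
qed

end
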